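(* Let $G$ and $H$ be graphs of coprime orders $N_1,N_2$ and positive edge counts $s_G,s_H$. Then $$\operatorname{FR}_{\min}(G\square H)\leq\frac{N_2\sqrt{s_G}\operatorname{FR}_{\min}(G)+N_1\sqrt{s_H}\operatorname{FR}_{\min}(H)}{\sqrt{N_2s_G+N_1s_H}},$$ where $G\square H$ denotes the Cartesian product.
   Context: Graphs are finite, simple and undirected. The Cartesian product $G\square H$ has vertex set $V(G)\times V(H)$, and $(g_1,h_1)$ is adjacent to $(g_2,h_2)$ if and only if either $g_1=g_2$ and $h_1$ is adjacent to $h_2$, or $h_1=h_2$ and $g_1$ is adjacent to $g_2$. A vertex labeling of a graph $G=(V,E)$ of order $N=|V|$ is a bijection $\sigma:V\to\mathbb Z_N=\mathbb Z/N\mathbb Z$. The adjacency matrix under $\sigma$ is the $N\times N$ matrix $A_\sigma$, indexed by $\mathbb Z_N\times\mathbb Z_N$, with $(A_\sigma)_{x,y}=1$ if the vertices labeled $x$ and $y$ are adjacent and $0$ otherwise. $F$ is the unitary Fourier matrix $F_{mx}=\frac1{\sqrt N}e^{-2\pi i mx/N}$. The Fourier ratio of a nonzero $N\times N$ matrix $M$ is $\operatorname{FR}(M)=\|FMF\|_1/\|FMF\|_2$, where $\|\cdot\|_1$ is the entrywise $\ell^1$-norm and $\|\cdot\|_2$ the Frobenius norm. The edge complexity of a graph with at least one edge is $\operatorname{FR}_{\min}(G)=\min_\sigma\operatorname{FR}(A_\sigma)$, the minimum over all vertex labelings (by $\mathbb Z_N$ with $N$ the order of that graph). *)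

theory Defs
  imports
    Complex_Main
    "HOL-Library.FuncSet"
    "Graph_Theory.Pair_Digraph"
    "Jordan_Normal_Form.Matrix"
begin

text \<open>
  Finite simple undirected graphs are the graphs of locale \<open>pair_graph\<close>: finite, loop-free
  and with a symmetric set of arcs. An undirected edge is thus a pair of opposite arcs.
\<close>

abbreviation graph_order :: "'a pair_pre_digraph \<Rightarrow> nat" where
  "graph_order G \<equiv> card (pverts G)"

definition edge_count :: "'a pair_pre_digraph \<Rightarrow> nat" where
  "edge_count G = card {{u, v} | u v. (u, v) \<in> parcs G}"

definition cartesian_product ::
    "'a pair_pre_digraph \<Rightarrow> 'b pair_pre_digraph \<Rightarrow> ('a \<times> 'b) pair_pre_digraph" where
  "cartesian_product G H =
    \<lparr> pverts = pverts G \<times> pverts H,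
      parcs = {((g\<^sub>1, h\<^sub>1), (g\<^sub>2, h\<^sub>2)) | g\<^sub>1 h\<^sub>1 g\<^sub>2 h\<^sub>2.
        (g\<^sub>1 \<in> pverts G \<and> g\<^sub>1 = g\<^sub>2 \<and> (h\<^sub>1, h\<^sub>2) \<in> parcs H) \<or>
        (h\<^sub>1 \<in> pverts H \<and> h\<^sub>1 = h\<^sub>2 \<and> (g\<^sub>1, g\<^sub>2) \<in> parcs G)} \<rparr>"

text \<open>
  The group of integers modulo \<open>N\<close> is represented by the residues \<open>{0..<N}\<close>, which are also the
  row and column indices of an \<open>N \<times> N\<close> matrix. Labelings are extensional functions, so that each
  labeling of the vertices is a single function.
\<close>

definition vertex_labelings :: "'a pair_pre_digraph \<Rightarrow> ('a \<Rightarrow> nat) set" where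
  "vertex_labelings G =
    {\<sigma> \<in> extensional (pverts G). bij_betw \<sigma> (pverts G) {0..<graph_order G}}"

definition adjacency_matrix :: "'a pair_pre_digraph \<Rightarrow> ('a \<Rightarrow> nat) \<Rightarrow> complex mat" where
  "adjacency_matrix G \<sigma> = mat (graph_order G) (graph_order G)
    (\<lambda>(x, y). if (inv_into (pverts G) \<sigma> x, inv_into (pverts G) \<sigma> y) \<in> parcs G then 1 else 0)"

definition fourier_matrix :: "nat \<Rightarrow> complex mat" where
  "fourier_matrix N = mat N N
    (\<lambda>(m, x). 1 / complex_of_real (sqrt (real N)) *
       exp (- (2 * complex_of_real pi * \<i> * of_nat m * of_nat x / of_nat N)))"

definition entrywise_l1_norm :: "complex mat \<Rightarrow> real" where
  "entrywise_l1_norm M = (\<Sum>i<dim_row M. \<Sum>j<dim_col M. cmod (M $$ (i, j)))"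

definition frobenius_norm :: "complex mat \<Rightarrow> real" where
  "frobenius_norm M = sqrt (\<Sum>i<dim_row M. \<Sum>j<dim_col M. (cmod (M $$ (i, j)))\<^sup>2)"

text \<open>Meaningful for nonzero square matrices only.\<close>

definition fourier_ratio :: "complex mat \<Rightarrow> real" where
  "fourier_ratio M =
    (let F = fourier_matrix (dim_row M)
     in entrywise_l1_norm (F * M * F) / frobenius_norm (F * M * F))"

text \<open>Meaningful for graphs with at least one edge only.\<close>

definition edge_complexity :: "'a pair_pre_digraph \<Rightarrow> real" where
  "edge_complexity G = Min ((\<lambda>\<sigma>. fourier_ratio (adjacency_matrix G \<sigma>)) ` vertex_labelings G)"

text \<open>The minimum ranges over a finite nonempty set.\<close>

lemma finite_vertex_labelings:
  assumes "finite (pverts G)"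
  shows "finite (vertex_labelings G)"
proof -
  have "vertex_labelings G \<subseteq> pverts G \<rightarrow>\<^sub>E {0..<graph_order G}"
    by (auto simp: vertex_labelings_def PiE_def bij_betw_def)
  then show ?thesis
    using assms by (meson finite_PiE finite_atLeastLessThan finite_subset)
qed

lemma vertex_labelings_nonempty:
  assumes "finite (pverts G)"
  shows "vertex_labelings G \<noteq> {}"
proof -
  obtain h where "bij_betw h (pverts G) {0..<graph_order G}"
    using assms ex_bij_betw_finite_nat by blast
  then have "restrict h (pverts G) \<in> vertex_labelings G"
    by (simp add: vertex_labelings_def)
  then show ?thesis by blast
qed

lemma pair_graph_cartesian_product:
  assumes "pair_graph G" "pair_graph H"
  shows "pair_graph (cartesian_product G H)"
proof -
  interpret G: pair_graph G by fact
  interpret H: pair_graph H by fact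
  let ?P = "cartesian_product G H"
  have sub: "parcs ?P \<subseteq> pverts ?P \<times> pverts ?P"
    by (auto simp: cartesian_product_def dest: G.in_arcsD1 G.in_arcsD2 H.in_arcsD1 H.in_arcsD2)
  have fin: "finite (pverts ?P)"
    by (simp add: cartesian_product_def G.pair_finite_verts H.pair_finite_verts)
  have sG: "(v, u) \<in> parcs G" if "(u, v) \<in> parcs G" for u v
    using G.pair_sym_arcs that by (auto simp: symmetric_def dest: symD)
  have sH: "(v, u) \<in> parcs H" if "(u, v) \<in> parcs H" for u v
    using H.pair_sym_arcs that by (auto simp: symmetric_def dest: symD)
  show ?thesis
  proof
    show "fst e \<in> pverts ?P" "snd e \<in> pverts ?P" if "e \<in> parcs ?P" for e
      using sub that by (auto simp: mem_Times_iff)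
    show "finite (pverts ?P)" by (fact fin)
    show "finite (parcs ?P)" using sub fin by (meson finite_SigmaI finite_subset)
    show "fst e \<noteq> snd e" if "e \<in> parcs ?P" for e
      using that by (auto simp: cartesian_product_def dest: G.pair_no_loops H.pair_no_loops)
    show "symmetric ?P"
      unfolding symmetric_def with_proj_simps
      by (rule symI) (auto simp: cartesian_product_def intro: sG sH)
  qed
qed

end

theory Submission
  imports Defs "HOL-Number_Theory.Cong"
begin

text \<open>
  For labelings \<open>\<sigma>\<close> of \<open>G\<close> and \<open>\<tau>\<close> of \<open>H\<close>, label the vertex \<open>(g, h)\<close> of the product by
  \<open>\<sigma> g N\<^sub>2 + \<tau> h N\<^sub>1\<close> modulo \<open>N\<^sub>1 N\<^sub>2\<close>, which is a labeling by coprimality. The characters of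
  \<open>\<int> / N\<^sub>1 N\<^sub>2\<close> then factor, and the transform of the product at \<open>(m, n)\<close> is the transform of \<open>G\<close>
  if \<open>N\<^sub>2\<close> divides \<open>m + n\<close>, plus the transform of \<open>H\<close> if \<open>N\<^sub>1\<close> divides \<open>m + n\<close>. Each pair of
  frequencies modulo \<open>N\<^sub>1\<close> lifts to exactly \<open>N\<^sub>2\<close> pairs with \<open>N\<^sub>2 dvd m + n\<close>, and symmetrically, so
  the entrywise norm of the product is at most \<open>N\<^sub>2\<close> times that of \<open>G\<close> plus \<open>N\<^sub>1\<close> times that of
  \<open>H\<close>. By Parseval each Frobenius norm is the square root of the number of arcs.
\<close>

section \<open>Additive characters modulo N and their orthogonality\<close>

definition additive_char :: "nat \<Rightarrow> int \<Rightarrow> complex" where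
  "additive_char N k = cis (- (2 * pi * real_of_int k / real N))"

lemma additive_char_0 [simp]: "additive_char N 0 = 1"
  by (simp add: additive_char_def)

lemma additive_char_add: "additive_char N (j + k) = additive_char N j * additive_char N k"
  by (simp add: additive_char_def cis_mult add_divide_distrib distrib_left)

lemma cnj_additive_char: "cnj (additive_char N k) = additive_char N (- k)"
  by (simp add: additive_char_def cis_cnj)

lemma additive_char_power: "additive_char N k ^ n = additive_char N (int n * k)"
  by (induction n) (auto simp: distrib_right additive_char_add)

lemma additive_char_eq_1_iff:
  assumes "N > 0"
  shows "additive_char N k = 1 \<longleftrightarrow> int N dvd k"
proof -
  have "cis x = 1 \<longleftrightarrow> cos x = 1" for x
    by (auto simp: complex_eq_iff cos_one_sin_zero)
  then have "additive_char N k = 1 \<longleftrightarrow> cos (- (2 * pi * real_of_int k / real N)) = 1"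
    unfolding additive_char_def .
  also have "\<dots> \<longleftrightarrow> (\<exists>j::int. - (2 * pi * real_of_int k / real N) = real_of_int j * 2 * pi)"
    by (rule cos_one_2pi_int)
  \<comment> \<open>The minus sign in the exponent makes \<open>- j\<close> the quotient of
    \<open>k\<close> by \<open>N\<close>.\<close>
  also have "\<dots> \<longleftrightarrow> (\<exists>j. k = int N * (- j))"
  proof (intro ex_cong1)
    fix j
    have "- (2 * pi * real_of_int k / real N) = real_of_int j * 2 * pi
        \<longleftrightarrow> pi * real_of_int k = pi * real_of_int (int N * (- j))"
      using assms by (auto simp: field_simps)
    also have "\<dots> \<longleftrightarrow> real_of_int k = real_of_int (int N * (- j))"
      by (simp only: mult_cancel_left) simp
    finally show "- (2 * pi * real_of_int k / real N) = real_of_int j * 2 * pi \<longleftrightarrow> k = int N * (- j)"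
      by (simp only: of_int_eq_iff)
  qed
  also have "\<dots> \<longleftrightarrow> int N dvd k"
    by (metis dvd_def minus_minus)
  finally show ?thesis .
qed

lemma additive_char_cong:
  assumes "N > 0" "[j = k] (mod int N)"
  shows "additive_char N j = additive_char N k"
proof -
  have "additive_char N (j - k) = 1"
    using assms by (simp add: additive_char_eq_1_iff cong_iff_dvd_diff)
  then show ?thesis
    using additive_char_add[of N "j - k" k] by simp
qed

text \<open>The factor \<open>d\<close> cancels in the exponent. This is how characters of the
  product modulus split into characters of the two factors.\<close>

lemma additive_char_mult_cancel:
  assumes "d > 0"
  shows "additive_char (N * d) (k * int d) = additive_char N k"
  using assms by (simp add: additive_char_def mult.assoc)

text \<open>A geometric sum whose ratio \<open>additive_char N k\<close> is an \<open>N\<close>-th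
  root of unity.\<close>

lemma sum_additive_char:
  assumes "N > 0"
  shows "(\<Sum>m<N. additive_char N (int m * k)) = (if int N dvd k then of_nat N else 0)"
proof (cases "int N dvd k")
  case True
  then have "additive_char N k = 1"
    using assms additive_char_eq_1_iff by blast
  with True show ?thesis
    by (simp flip: additive_char_power)
next
  case False
  then have ne: "additive_char N k \<noteq> 1"
    using assms additive_char_eq_1_iff by blast
  have "additive_char N k ^ N = 1"
    using assms by (simp add: additive_char_power additive_char_eq_1_iff)
  with ne False show ?thesis
    by (simp add: geometric_sum flip: additive_char_power)
qed

section \<open>The Fourier transform of an arc set\<close>

text \<open>For a labeling this is an entry of \<open>FMF\<close>, the two factors
  \<open>1 / sqrt N\<close> giving the division by \<open>N\<close>. Summing over arcs avoids the
  inverse labeling, and frequencies range over all naturals, so that those of the product can be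
  inserted unreduced.\<close>

definition arc_transform ::
    "('a \<times> 'a) set \<Rightarrow> ('a \<Rightarrow> nat) \<Rightarrow> nat \<Rightarrow> nat \<Rightarrow> nat \<Rightarrow> complex" where
  "arc_transform E \<sigma> N m n =
    (\<Sum>(u, v)\<in>E. additive_char N (int m * int (\<sigma> u) + int n * int (\<sigma> v))) / of_nat N"

lemma arc_transform_mod:
  assumes "N > 0"
  shows "arc_transform E \<sigma> N (m mod N) (n mod N) = arc_transform E \<sigma> N m n"
  unfolding arc_transform_def
  by (intro arg_cong2[of _ _ _ _ "(/)"] sum.cong refl)
    (auto intro!: additive_char_cong[OF assms] cong_add cong_mult simp: zmod_int)

lemma fourier_matrix_index:
  assumes "m < N" "x < N"
  shows "fourier_matrix N $$ (m, x) = additive_char N (int m * int x) / complex_of_real (sqrt (real N))"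
  using assms
  by (simp add: fourier_matrix_def additive_char_def cis_conv_exp mult_ac)

lemma fourier_conjugate_index:
  assumes M: "M \<in> carrier_mat N N" and mn: "m < N" "n < N"
  shows "(fourier_matrix N * M * fourier_matrix N) $$ (m, n) =
    (\<Sum>x<N. \<Sum>y<N. M $$ (x, y) * additive_char N (int m * int x + int n * int y)) / of_nat N"
proof -
  have F: "fourier_matrix N \<in> carrier_mat N N"
    by (simp add: fourier_matrix_def)
  have s: "complex_of_real (sqrt (real N)) * complex_of_real (sqrt (real N)) = of_nat N"
    by (metis of_nat_0_le_iff of_real_mult of_real_of_nat_eq real_sqrt_mult_self abs_of_nonneg)
  have "(fourier_matrix N * M * fourier_matrix N) $$ (m, n) =
      (\<Sum>y<N. (\<Sum>x<N. fourier_matrix N $$ (m, x) * M $$ (x, y)) * fourier_matrix N $$ (y, n))"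
    using M F mn by (simp add: scalar_prod_def lessThan_atLeast0 del: assoc_mult_mat)
  also have "\<dots> = (\<Sum>y<N. \<Sum>x<N. M $$ (x, y) * additive_char N (int m * int x + int n * int y) / of_nat N)"
    using mn
    by (simp add: sum_distrib_left sum_distrib_right sum_divide_distrib
        fourier_matrix_index additive_char_add mult_ac flip: s)
  also have "\<dots> = (\<Sum>x<N. \<Sum>y<N. M $$ (x, y) * additive_char N (int m * int x + int n * int y)) / of_nat N"
    by (subst sum.swap) (simp add: sum_divide_distrib)
  finally show ?thesis .
qed

text \<open>Substituting \<open>x = \<sigma> u\<close> and \<open>y = \<sigma> v\<close> undoes the
  inverse labeling, and the matrix entries confine the sum to arcs.\<close>

lemma fourier_adjacency_index:
  assumes "pair_graph G" "\<sigma> \<in> vertex_labelings G"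
    and mn: "m < graph_order G" "n < graph_order G"
  defines "N \<equiv> graph_order G"
  shows "(fourier_matrix N * adjacency_matrix G \<sigma> * fourier_matrix N) $$ (m, n) =
    arc_transform (parcs G) \<sigma> N m n"
proof -
  interpret pair_graph G by fact
  have bij: "bij_betw \<sigma> (pverts G) {..<N}"
    using assms by (simp add: vertex_labelings_def lessThan_atLeast0)
  then have inj: "inj_on \<sigma> (pverts G)"
    by (simp add: bij_betw_def)
  have sub: "parcs G \<subseteq> pverts G \<times> pverts G"
    by (auto dest: in_arcsD1 in_arcsD2)
  let ?c = "\<lambda>x y. additive_char N (int m * int x + int n * int y)"
  have "(\<Sum>x<N. \<Sum>y<N. adjacency_matrix G \<sigma> $$ (x, y) * ?c x y) =
      (\<Sum>x<N. \<Sum>y<N. if (inv_into (pverts G) \<sigma> x, inv_into (pverts G) \<sigma> y) \<in> parcs G then ?c x y else 0)"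
    by (intro sum.cong refl) (simp add: adjacency_matrix_def N_def)
  also have "\<dots> = (\<Sum>u\<in>pverts G. \<Sum>v\<in>pverts G. if (u, v) \<in> parcs G then ?c (\<sigma> u) (\<sigma> v) else 0)"
    by (simp add: inv_into_f_f[OF inj] flip: sum.reindex_bij_betw[OF bij])
  also have "\<dots> = (\<Sum>(u, v)\<in>pverts G \<times> pverts G. if (u, v) \<in> parcs G then ?c (\<sigma> u) (\<sigma> v) else 0)"
    by (rule sum.cartesian_product)
  also have "\<dots> = (\<Sum>(u, v)\<in>parcs G. ?c (\<sigma> u) (\<sigma> v))"
    using sub by (intro sum.mono_neutral_cong_right) auto
  finally show ?thesis
    using mn unfolding arc_transform_def
    by (subst fourier_conjugate_index) (simp_all add: adjacency_matrix_def N_def)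
qed

text \<open>Expanding the square gives pairs of arcs \<open>e\<close>, \<open>f\<close>. When the
  frequencies are summed first, orthogonality keeps only the pairs with \<open>e = f\<close>, and
  each of these contributes \<open>N * N\<close>, which cancels the normalisation.\<close>

lemma arc_transform_parseval:
  assumes N: "N > 0" and inj: "inj_on \<sigma> V" and le: "\<sigma> ` V \<subseteq> {..<N}"
    and E: "E \<subseteq> V \<times> V" "finite E"
  shows "(\<Sum>m<N. \<Sum>n<N. (cmod (arc_transform E \<sigma> N m n))\<^sup>2) = real (card E)"
proof -
  let ?d = "\<lambda>e f. int (\<sigma> (fst e)) - int (\<sigma> (fst f))"
  let ?d' = "\<lambda>e f. int (\<sigma> (snd e)) - int (\<sigma> (snd f))"
  \<comment> \<open>Labels lie below \<open>N\<close>, so congruent labels are equal and injectivity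
    applies.\<close>
  have dvd: "int N dvd int (\<sigma> u) - int (\<sigma> v) \<longleftrightarrow> u = v" if "u \<in> V" "v \<in> V" for u v
  proof -
    have "\<sigma> u < N" "\<sigma> v < N"
      using le that by auto
    then have "int N dvd int (\<sigma> u) - int (\<sigma> v) \<longleftrightarrow> \<sigma> u = \<sigma> v"
      by (metis cong_iff_dvd_diff cong_int_iff cong_less_modulus_unique_nat cong_refl)
    then show ?thesis
      using inj that by (auto dest: inj_onD)
  qed
  have EV: "fst e \<in> V" "snd e \<in> V" if "e \<in> E" for e
    using E(1) that by auto
  have "complex_of_real (\<Sum>m<N. \<Sum>n<N. (cmod (arc_transform E \<sigma> N m n))\<^sup>2) =
      (\<Sum>m<N. \<Sum>n<N. arc_transform E \<sigma> N m n * cnj (arc_transform E \<sigma> N m n))"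
    by (simp only: of_real_sum complex_norm_square)
  also have "\<dots> = (\<Sum>m<N. \<Sum>n<N. \<Sum>e\<in>E. \<Sum>f\<in>E.
      additive_char N (int m * ?d e f) * additive_char N (int n * ?d' e f)) / (of_nat N)\<^sup>2"
    unfolding arc_transform_def case_prod_unfold
    by (simp add: sum_product cnj_additive_char sum_divide_distrib power2_eq_square algebra_simps
        flip: additive_char_add)
  also have "(\<Sum>m<N. \<Sum>n<N. \<Sum>e\<in>E. \<Sum>f\<in>E.
      additive_char N (int m * ?d e f) * additive_char N (int n * ?d' e f)) =
      (\<Sum>e\<in>E. \<Sum>f\<in>E. \<Sum>m<N. \<Sum>n<N.
        additive_char N (int m * ?d e f) * additive_char N (int n * ?d' e f))"
    by (simp only: sum.swap[of _ E "{..<N}"])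
  also have "\<dots> = (\<Sum>e\<in>E. \<Sum>f\<in>E. (\<Sum>m<N. additive_char N (int m * ?d e f)) *
        (\<Sum>n<N. additive_char N (int n * ?d' e f)))"
    by (simp add: sum_product)
  also have "\<dots> = (\<Sum>e\<in>E. \<Sum>f\<in>E. if e = f then (of_nat N)\<^sup>2 else 0)"
    by (intro sum.cong refl)
      (simp add: sum_additive_char[OF N] dvd EV prod_eq_iff power2_eq_square)
  also have "\<dots> = of_nat (card E) * (of_nat N)\<^sup>2"
    using E by simp
  finally have "complex_of_real (\<Sum>m<N. \<Sum>n<N. (cmod (arc_transform E \<sigma> N m n))\<^sup>2) =
      complex_of_real (real (card E))"
    using N by simp
  then show ?thesis
    by (simp only: of_real_eq_iff)
qed

text \<open>By Parseval the denominator does not depend on the labeling, so only the entrywise norm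
  is left to bound.\<close>

lemma fourier_ratio_adjacency:
  assumes G: "pair_graph G" and \<sigma>: "\<sigma> \<in> vertex_labelings G" and N: "graph_order G > 0"
  shows "fourier_ratio (adjacency_matrix G \<sigma>) =
    (\<Sum>m<graph_order G. \<Sum>n<graph_order G. cmod (arc_transform (parcs G) \<sigma> (graph_order G) m n))
      / sqrt (real (card (parcs G)))"
proof -
  interpret pair_graph G by fact
  let ?N = "graph_order G"
  let ?F = "fourier_matrix ?N"
  let ?M = "?F * adjacency_matrix G \<sigma> * ?F"
  have dim: "dim_row ?M = ?N" "dim_col ?M = ?N" "dim_row (adjacency_matrix G \<sigma>) = ?N"
    by (simp_all add: fourier_matrix_def adjacency_matrix_def)
  have "(\<Sum>m<?N. \<Sum>n<?N. (cmod (arc_transform (parcs G) \<sigma> ?N m n))\<^sup>2) = real (card (parcs G))"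
    using \<sigma> N by (intro arc_transform_parseval[where V = "pverts G"])
      (auto simp: vertex_labelings_def bij_betw_def dest: in_arcsD1 in_arcsD2)
  then have "frobenius_norm ?M = sqrt (real (card (parcs G)))"
    by (simp add: frobenius_norm_def dim fourier_adjacency_index[OF G \<sigma>] del: index_mult_mat)
  then show ?thesis
    by (simp add: fourier_ratio_def Let_def entrywise_l1_norm_def dim
        fourier_adjacency_index[OF G \<sigma>] del: index_mult_mat)
qed

section \<open>Arcs and edges\<close>

text \<open>Each fibre of the map from arcs to unordered pairs consists of an arc and its reverse:
  symmetry supplies the reverse, and the absence of loops keeps the two apart.\<close>

lemma card_parcs_eq:
  assumes "pair_graph G"
  shows "card (parcs G) = 2 * edge_count G"
proof -
  interpret pair_graph G by fact
  let ?f = "\<lambda>(u, v). {u, v}"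
  have sym: "(v, u) \<in> parcs G" if "(u, v) \<in> parcs G" for u v
    using pair_sym_arcs that by (auto simp: symmetric_def dest: symD)
  have img: "?f ` parcs G = {{u, v} | u v. (u, v) \<in> parcs G}"
    by auto
  have "card {e \<in> parcs G. ?f e = S} = 2" if S: "S \<in> ?f ` parcs G" for S
  proof -
    obtain u v where uv: "(u, v) \<in> parcs G" "S = {u, v}"
      using S by auto
    then have "u \<noteq> v"
      using pair_no_loops by fastforce
    moreover have "{e \<in> parcs G. ?f e = S} = {(u, v), (v, u)}"
      using uv sym by (auto simp: doubleton_eq_iff)
    ultimately show ?thesis
      by simp
  qed
  then have "(\<Sum>S\<in>?f ` parcs G. card {e \<in> parcs G. ?f e = S}) = 2 * card (?f ` parcs G)"
    by simp
  moreover have "(\<Sum>S\<in>?f ` parcs G. card {e \<in> parcs G. ?f e = S}) = card (parcs G)"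
    using sum.image_gen[OF pair_finite_arcs, of "\<lambda>_. 1::nat" ?f] by simp
  ultimately show ?thesis
    by (simp add: edge_count_def img)
qed

section \<open>Summation over frequencies by residues\<close>

text \<open>The pair of residues is injective by coprimality, and the cardinalities agree, so it is
  a bijection along which the sum is reindexed.\<close>

lemma sum_chinese_remainder:
  fixes f :: "nat \<Rightarrow> nat \<Rightarrow> 'c::comm_monoid_add"
  assumes "coprime k l" "k > 0" "l > 0"
  shows "(\<Sum>m<k * l. f (m mod k) (m mod l)) = (\<Sum>a<k. \<Sum>b<l. f a b)"
proof -
  let ?h = "\<lambda>m. (m mod k, m mod l)"
  have inj: "inj_on ?h {..<k * l}"
  proof (rule inj_onI)
    fix x y assume *: "x \<in> {..<k * l}" "y \<in> {..<k * l}" "?h x = ?h y"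
    then have "[x = y] (mod k * l)"
      using assms by (intro coprime_cong_mult_nat) (auto simp: cong_def)
    with * show "x = y"
      by (auto simp: cong_def)
  qed
  have "?h ` {..<k * l} = {..<k} \<times> {..<l}"
    using inj assms by (intro card_subset_eq) (auto simp: card_image)
  with inj have "bij_betw ?h {..<k * l} ({..<k} \<times> {..<l})"
    by (simp add: bij_betw_def)
  then have "(\<Sum>m<k * l. case ?h m of (a, b) \<Rightarrow> f a b) = (\<Sum>(a, b)\<in>{..<k} \<times> {..<l}. f a b)"
    by (rule sum.reindex_bij_betw)
  then show ?thesis
    by (simp add: sum.cartesian_product)
qed

text \<open>For each \<open>c\<close> exactly one \<open>d\<close> below \<open>l\<close>
  qualifies.\<close>

lemma sum_antidiagonal_mod:
  assumes "(l::nat) > 0"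
  shows "(\<Sum>c<l. \<Sum>d<l. if l dvd c + d then x else 0) = real l * x"
proof -
  have "(\<Sum>d<l. if l dvd c + d then x else 0) = x" if "c < l" for c
  proof -
    \<comment> \<open>The \<open>mod\<close> matters only for \<open>c = 0\<close>, where
      \<open>l - c\<close> is not below \<open>l\<close>.\<close>
    have "l dvd c + d \<longleftrightarrow> d = (l - c) mod l" if "d < l" for d
    proof (cases "c = 0")
      case True
      with that show ?thesis by (auto dest: dvd_imp_le)
    next
      case False
      have "l dvd c + d \<longleftrightarrow> c + d = l"
      proof
        assume "l dvd c + d"
        then obtain j where j: "c + d = l * j" by auto
        have "0 < l * j" "l * j < l * 2"
          using False j \<open>c < l\<close> \<open>d < l\<close> by linarith+
        then have "j = 1" by simp
        with j show "c + d = l" by simp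
      qed simp
      with False \<open>c < l\<close> show ?thesis by auto
    qed
    then have "(\<Sum>d<l. if l dvd c + d then x else 0) = (\<Sum>d<l. if d = (l - c) mod l then x else 0)"
      by (intro sum.cong) auto
    also have "\<dots> = x"
      using assms by (simp add: sum.delta)
    finally show ?thesis .
  qed
  then show ?thesis by simp
qed

text \<open>The transform sees only residues modulo \<open>k\<close> and the divisibility condition
  only residues modulo \<open>l\<close>, so splitting both \<open>m\<close> and \<open>n\<close>
  into residues decouples them. The factor \<open>l\<close> counts the residue pairs
  \<open>(c, d)\<close> with \<open>l dvd c + d\<close>.\<close>

lemma sum_arc_transform_restrict:
  assumes "coprime k l" "k > 0" "l > 0"
  shows "(\<Sum>m<k * l. \<Sum>n<k * l. if l dvd m + n then cmod (arc_transform E \<sigma> k m n) else 0) =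
    real l * (\<Sum>a<k. \<Sum>b<k. cmod (arc_transform E \<sigma> k a b))"
proof -
  let ?f = "\<lambda>a b. cmod (arc_transform E \<sigma> k a b)"
  have "(\<Sum>m<k * l. \<Sum>n<k * l. if l dvd m + n then ?f m n else 0) =
      (\<Sum>m<k * l. \<Sum>n<k * l. if l dvd m mod l + n mod l then ?f (m mod k) (n mod k) else 0)"
    by (simp add: arc_transform_mod[OF assms(2)] dvd_eq_mod_eq_0 mod_add_eq cong: if_cong)
  also have "\<dots> = (\<Sum>m<k * l. \<Sum>b<k. \<Sum>d<l. if l dvd m mod l + d then ?f (m mod k) b else 0)"
    by (intro sum.cong refl
        sum_chinese_remainder[OF assms, of "\<lambda>b d. if l dvd _ mod l + d then ?f (_ mod k) b else 0"])
  also have "\<dots> = (\<Sum>a<k. \<Sum>c<l. \<Sum>b<k. \<Sum>d<l. if l dvd c + d then ?f a b else 0)"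
    by (rule sum_chinese_remainder[OF assms,
          of "\<lambda>a c. \<Sum>b<k. \<Sum>d<l. if l dvd c + d then ?f a b else 0"])
  also have "\<dots> = (\<Sum>a<k. \<Sum>b<k. \<Sum>c<l. \<Sum>d<l. if l dvd c + d then ?f a b else 0)"
    by (intro sum.cong refl sum.swap)
  also have "\<dots> = real l * (\<Sum>a<k. \<Sum>b<k. ?f a b)"
    by (simp add: sum_antidiagonal_mod[OF assms(3)] sum_distrib_left)
  finally show ?thesis .
qed

section \<open>Arcs and labelings of the Cartesian product\<close>

text \<open>An arc moves in one factor and is stationary in the other. Writing the arcs as images
  prepares the reindexing of sums over them.\<close>

lemma parcs_cartesian_product:
  fixes G :: "'a pair_pre_digraph" and H :: "'b pair_pre_digraph"
  shows "parcs (cartesian_product G H) =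
    (\<lambda>((u, v), h). ((u, h), (v, h))) ` (parcs G \<times> pverts H) \<union>
    (\<lambda>((u, v), g). ((g, u), (g, v))) ` (parcs H \<times> pverts G)"
  (is "_ = ?X \<union> ?Y")
proof (rule Set.set_eqI)
  fix e :: "('a \<times> 'b) \<times> 'a \<times> 'b"
  obtain g h g' h' where e: "e = ((g, h), (g', h'))"
    by (metis surj_pair)
  have "((g, h), (g', h')) \<in> ?X \<longleftrightarrow> h \<in> pverts H \<and> h = h' \<and> (g, g') \<in> parcs G"
    by (auto intro: rev_image_eqI)
  moreover have "((g, h), (g', h')) \<in> ?Y \<longleftrightarrow> g \<in> pverts G \<and> g = g' \<and> (h, h') \<in> parcs H"
    by (auto intro: rev_image_eqI)
  ultimately show "e \<in> parcs (cartesian_product G H) \<longleftrightarrow> e \<in> ?X \<union> ?Y"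
    unfolding e by (auto simp: cartesian_product_def)
qed

lemma sum_parcs_cartesian_product:
  assumes "pair_graph G" "pair_graph H"
  shows "(\<Sum>(p, q)\<in>parcs (cartesian_product G H). f p q) =
    (\<Sum>(u, v)\<in>parcs G. \<Sum>h\<in>pverts H. f (u, h) (v, h)) +
    (\<Sum>(u, v)\<in>parcs H. \<Sum>g\<in>pverts G. f (g, u) (g, v))"
proof -
  interpret G: pair_graph G by fact
  interpret H: pair_graph H by fact
  let ?i = "\<lambda>((u, v), h). ((u, h), (v, h))" and ?j = "\<lambda>((u, v), g). ((g, u), (g, v))"
  \<comment> \<open>An arc of both kinds would have equal first coordinates and so yield a loop of
    \<open>G\<close>.\<close>
  have "?i ` (parcs G \<times> pverts H) \<inter> ?j ` (parcs H \<times> pverts G) = {}"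
    by (auto dest: G.pair_no_loops)
  then have "(\<Sum>(p, q)\<in>parcs (cartesian_product G H). f p q) =
      (\<Sum>(p, q)\<in>?i ` (parcs G \<times> pverts H). f p q) + (\<Sum>(p, q)\<in>?j ` (parcs H \<times> pverts G). f p q)"
    unfolding parcs_cartesian_product by (intro sum.union_disjoint) auto
  moreover have "inj_on ?i (parcs G \<times> pverts H)" "inj_on ?j (parcs H \<times> pverts G)"
    by (auto simp: inj_on_def)
  ultimately show ?thesis
    by (simp add: sum.reindex sum.cartesian_product case_prod_unfold)
qed

text \<open>With \<open>k\<close> and \<open>l\<close> the orders, dividing
  \<open>\<sigma> g * l + \<tau> h * k\<close> by \<open>k * l\<close> gives
  \<open>\<sigma> g / k + \<tau> h / l\<close>, so characters split without modular inverses.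
  \<open>restrict\<close> makes the map extensional, as a labeling must be.\<close>

definition product_labeling ::
    "'a pair_pre_digraph \<Rightarrow> 'b pair_pre_digraph \<Rightarrow> ('a \<Rightarrow> nat) \<Rightarrow> ('b \<Rightarrow> nat) \<Rightarrow> 'a \<times> 'b \<Rightarrow> nat" where
  "product_labeling G H \<sigma> \<tau> = restrict
    (\<lambda>(g, h). (\<sigma> g * graph_order H + \<tau> h * graph_order G) mod (graph_order G * graph_order H))
    (pverts G \<times> pverts H)"

lemma graph_order_cartesian_product:
  "graph_order (cartesian_product G H) = graph_order G * graph_order H"
  by (simp add: cartesian_product_def card_cartesian_product)

lemma product_labeling_in_vertex_labelings:
  assumes "\<sigma> \<in> vertex_labelings G" "\<tau> \<in> vertex_labelings H"
    and cop: "coprime (graph_order G) (graph_order H)"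
    and pos: "graph_order G > 0" "graph_order H > 0"
  shows "product_labeling G H \<sigma> \<tau> \<in> vertex_labelings (cartesian_product G H)"
proof -
  let ?k = "graph_order G" and ?l = "graph_order H"
  let ?\<rho> = "product_labeling G H \<sigma> \<tau>"
  have \<sigma>: "inj_on \<sigma> (pverts G)" "\<And>g. g \<in> pverts G \<Longrightarrow> \<sigma> g < ?k"
    and \<tau>: "inj_on \<tau> (pverts H)" "\<And>h. h \<in> pverts H \<Longrightarrow> \<tau> h < ?l"
    using assms by (auto simp: vertex_labelings_def bij_betw_def)
  have inj: "inj_on ?\<rho> (pverts G \<times> pverts H)"
  proof (rule inj_onI, clarify)
    fix g h g' h'
    assume *: "g \<in> pverts G" "g' \<in> pverts G" "h \<in> pverts H" "h' \<in> pverts H"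
      and eq: "?\<rho> (g, h) = ?\<rho> (g', h')"
    then have c: "[\<sigma> g * ?l + \<tau> h * ?k = \<sigma> g' * ?l + \<tau> h' * ?k] (mod ?k * ?l)"
      by (simp add: product_labeling_def cong_def)
    \<comment> \<open>Modulo one order the other summand vanishes, and the remaining multiplier is a
      unit by coprimality.\<close>
    have "[\<sigma> g * ?l = \<sigma> g' * ?l] (mod ?k)"
      using cong_modulus_mult_nat[OF c] by (simp add: cong_def)
    then have "[\<sigma> g = \<sigma> g'] (mod ?k)"
      using cop by (simp add: cong_mult_rcancel_nat coprime_commute)
    moreover have "[\<tau> h * ?k = \<tau> h' * ?k] (mod ?l)"
      using cong_modulus_mult_nat[OF c[unfolded mult.commute[of ?k ?l]]] by (simp add: cong_def)
    then have "[\<tau> h = \<tau> h'] (mod ?l)"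
      using cop by (simp add: cong_mult_rcancel_nat coprime_commute)
    ultimately have "\<sigma> g = \<sigma> g'" "\<tau> h = \<tau> h'"
      using \<sigma>(2) \<tau>(2) * by (simp_all add: cong_def)
    with * \<sigma>(1) \<tau>(1) show "g = g' \<and> h = h'"
      by (auto dest: inj_onD)
  qed
  \<comment> \<open>Surjectivity follows from injectivity, as source and target have the same
    cardinality.\<close>
  moreover have "?\<rho> ` (pverts G \<times> pverts H) = {0..<?k * ?l}"
    using inj pos by (intro card_subset_eq)
      (auto simp: card_image card_cartesian_product product_labeling_def)
  ultimately show ?thesis
    by (simp add: vertex_labelings_def bij_betw_def graph_order_cartesian_product)
      (simp add: cartesian_product_def product_labeling_def)
qed

text \<open>
  With this labeling the frequency \<open>m\<close> modulo \<open>kl\<close> restricts to the frequencies \<open>m mod k\<close> and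
  \<open>m mod l\<close> on the factors, so no multiplicative twist appears in the indices on the right.
\<close>

lemma arc_transform_cartesian_product:
  assumes G: "pair_graph G" and H: "pair_graph H"
    and \<sigma>: "\<sigma> \<in> vertex_labelings G" and \<tau>: "\<tau> \<in> vertex_labelings H"
    and pos: "graph_order G > 0" "graph_order H > 0"
  defines "k \<equiv> graph_order G" and "l \<equiv> graph_order H"
  shows "arc_transform (parcs (cartesian_product G H)) (product_labeling G H \<sigma> \<tau>) (k * l) m n =
    (if l dvd m + n then arc_transform (parcs G) \<sigma> k m n else 0) +
    (if k dvd m + n then arc_transform (parcs H) \<tau> l m n else 0)"
proof -
  interpret G: pair_graph G by fact
  interpret H: pair_graph H by fact
  let ?\<rho> = "product_labeling G H \<sigma> \<tau>"
  let ?c = "\<lambda>N x y. additive_char N (int m * int x + int n * int y)"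
  have kl: "k > 0" "l > 0"
    using pos by (simp_all add: k_def l_def)
  have split: "?c (k * l) (?\<rho> (g, h)) (?\<rho> (g', h')) = ?c k (\<sigma> g) (\<sigma> g') * ?c l (\<tau> h) (\<tau> h')"
    if "g \<in> pverts G" "g' \<in> pverts G" "h \<in> pverts H" "h' \<in> pverts H" for g g' h h'
  proof -
    have "?c (k * l) (?\<rho> (g, h)) (?\<rho> (g', h')) =
        ?c (k * l) (\<sigma> g * l + \<tau> h * k) (\<sigma> g' * l + \<tau> h' * k)"
      using that kl by (intro additive_char_cong cong_add cong_mult cong_refl)
        (auto simp: product_labeling_def k_def l_def zmod_int)
    \<comment> \<open>Each label is multiplied by the order of the other factor, which
      \<open>additive_char_mult_cancel\<close> strips off; the swapped modulus \<open>l * k\<close>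
      fits its form.\<close>
    also have "\<dots> = additive_char (k * l) ((int m * int (\<sigma> g) + int n * int (\<sigma> g')) * int l) *
        additive_char (l * k) ((int m * int (\<tau> h) + int n * int (\<tau> h')) * int k)"
      by (simp add: mult.commute[of l k] algebra_simps flip: additive_char_add)
    also have "\<dots> = ?c k (\<sigma> g) (\<sigma> g') * ?c l (\<tau> h) (\<tau> h')"
      using kl by (simp only: additive_char_mult_cancel)
    finally show ?thesis .
  qed
  \<comment> \<open>Along an arc of one factor the other coordinate is stationary, so its vertices
    contribute the full character sum at frequency \<open>m + n\<close>. This is the origin of the
    divisibility conditions.\<close>
  have diag: "(\<Sum>v\<in>pverts K. ?c N (\<upsilon> v) (\<upsilon> v)) = (if N dvd m + n then of_nat N else 0)"
    if "\<upsilon> \<in> vertex_labelings K" "N = graph_order K" "N > 0"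
    for K :: "'c pair_pre_digraph" and \<upsilon> N
  proof -
    have "bij_betw \<upsilon> (pverts K) {..<N}"
      using that by (simp add: vertex_labelings_def lessThan_atLeast0)
    then have "(\<Sum>v\<in>pverts K. ?c N (\<upsilon> v) (\<upsilon> v)) = (\<Sum>x<N. ?c N x x)"
      by (rule sum.reindex_bij_betw)
    also have "\<dots> = (\<Sum>x<N. additive_char N (int x * int (m + n)))"
      by (simp add: algebra_simps)
    also have "\<dots> = (if N dvd m + n then of_nat N else 0)"
      using that(3) by (simp only: sum_additive_char int_dvd_int_iff)
    finally show ?thesis .
  qed
  have "(\<Sum>(p, q)\<in>parcs (cartesian_product G H). ?c (k * l) (?\<rho> p) (?\<rho> q)) =
      (\<Sum>(u, v)\<in>parcs G. \<Sum>h\<in>pverts H. ?c k (\<sigma> u) (\<sigma> v) * ?c l (\<tau> h) (\<tau> h)) +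
      (\<Sum>(u, v)\<in>parcs H. \<Sum>g\<in>pverts G. ?c k (\<sigma> g) (\<sigma> g) * ?c l (\<tau> u) (\<tau> v))"
    unfolding sum_parcs_cartesian_product[OF G H]
    by (intro arg_cong2[of _ _ _ _ "(+)"] sum.cong refl)
      (auto intro!: sum.cong split dest: G.in_arcsD1 G.in_arcsD2 H.in_arcsD1 H.in_arcsD2)
  also have "\<dots> = (\<Sum>(u, v)\<in>parcs G. ?c k (\<sigma> u) (\<sigma> v)) * (if l dvd m + n then of_nat l else 0) +
      (\<Sum>(u, v)\<in>parcs H. ?c l (\<tau> u) (\<tau> v)) * (if k dvd m + n then of_nat k else 0)"
    unfolding diag[OF \<sigma> meta_eq_to_obj_eq[OF k_def] kl(1), symmetric]
      diag[OF \<tau> meta_eq_to_obj_eq[OF l_def] kl(2), symmetric]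
    by (simp add: sum_product case_prod_unfold) (simp add: mult.commute)
  \<comment> \<open>The vertex sum contributes \<open>l\<close> or \<open>k\<close>, which turns the
    normalisation \<open>1 / (k * l)\<close> into \<open>1 / k\<close> or
    \<open>1 / l\<close>.\<close>
  finally show ?thesis
    using kl by (simp add: arc_transform_def field_simps)
qed

section \<open>The minimum over labelings and its bound\<close>

lemma edge_complexity_attained:
  assumes "pair_graph G"
  obtains \<sigma> where "\<sigma> \<in> vertex_labelings G"
    "edge_complexity G = fourier_ratio (adjacency_matrix G \<sigma>)"
proof -
  interpret pair_graph G by fact
  have "edge_complexity G \<in> (\<lambda>\<sigma>. fourier_ratio (adjacency_matrix G \<sigma>)) ` vertex_labelings G"
    unfolding edge_complexity_def
    by (intro Min_in finite_imageI finite_vertex_labelings) (simp_all add: vertex_labelings_nonempty)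
  with that show ?thesis by auto
qed

lemma edge_complexity_le:
  assumes "pair_graph G" "\<sigma> \<in> vertex_labelings G"
  shows "edge_complexity G \<le> fourier_ratio (adjacency_matrix G \<sigma>)"
proof -
  interpret pair_graph G by fact
  show ?thesis
    unfolding edge_complexity_def using assms(2) by (intro Min_le) (simp_all add: finite_vertex_labelings)
qed

lemma graph_order_pos:
  assumes "pair_graph G" "edge_count G > 0"
  shows "graph_order G > 0"
proof -
  interpret pair_graph G by fact
  have "parcs G \<noteq> {}"
    using card_parcs_eq[OF assms(1)] assms(2) by auto
  then show ?thesis
    by (auto simp: card_gt_0_iff dest: in_arcsD1)
qed

theorem proposition3p5:
  fixes G :: "'a pair_pre_digraph" and H :: "'b pair_pre_digraph"
    and N\<^sub>1 N\<^sub>2 s\<^sub>G s\<^sub>H :: nat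
  assumes "pair_graph G" and "pair_graph H"
    and "graph_order G = N\<^sub>1" and "graph_order H = N\<^sub>2" and "coprime N\<^sub>1 N\<^sub>2"
    and "edge_count G = s\<^sub>G" and "edge_count H = s\<^sub>H" and "s\<^sub>G > 0" and "s\<^sub>H > 0"
  shows "edge_complexity (cartesian_product G H) \<le>
    (real N\<^sub>2 * sqrt (real s\<^sub>G) * edge_complexity G + real N\<^sub>1 * sqrt (real s\<^sub>H) * edge_complexity H)
      / sqrt (real N\<^sub>2 * real s\<^sub>G + real N\<^sub>1 * real s\<^sub>H)"
proof -
  let ?P = "cartesian_product G H"
  note G = assms(1) and H = assms(2) and cop = assms(5)
  have P: "pair_graph ?P"
    using G H by (rule pair_graph_cartesian_product)
  have pos: "N\<^sub>1 > 0" "N\<^sub>2 > 0"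
    using graph_order_pos[OF G] graph_order_pos[OF H] assms by auto
  \<comment> \<open>Optimal labelings of the factors are combined. The result need not be optimal
    for the product, since any labeling bounds the minimum from above.\<close>
  obtain \<sigma> where \<sigma>: "\<sigma> \<in> vertex_labelings G"
      "edge_complexity G = fourier_ratio (adjacency_matrix G \<sigma>)"
    using G by (rule edge_complexity_attained)
  obtain \<tau> where \<tau>: "\<tau> \<in> vertex_labelings H"
      "edge_complexity H = fourier_ratio (adjacency_matrix H \<tau>)"
    using H by (rule edge_complexity_attained)
  let ?\<rho> = "product_labeling G H \<sigma> \<tau>"
  have \<rho>: "?\<rho> \<in> vertex_labelings ?P"
    using \<sigma>(1) \<tau>(1) cop pos assms(3,4) by (intro product_labeling_in_vertex_labelings) auto
  let ?A = "\<Sum>a<N\<^sub>1. \<Sum>b<N\<^sub>1. cmod (arc_transform (parcs G) \<sigma> N\<^sub>1 a b)"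
  let ?B = "\<Sum>a<N\<^sub>2. \<Sum>b<N\<^sub>2. cmod (arc_transform (parcs H) \<tau> N\<^sub>2 a b)"
  let ?N = "N\<^sub>1 * N\<^sub>2"
  \<comment> \<open>The triangle inequality is strict at most at frequencies where both
    \<open>N\<^sub>1\<close> and \<open>N\<^sub>2\<close> divide \<open>m + n\<close>.\<close>
  have "(\<Sum>m<?N. \<Sum>n<?N. cmod (arc_transform (parcs ?P) ?\<rho> ?N m n)) \<le>
      (\<Sum>m<?N. \<Sum>n<?N. (if N\<^sub>2 dvd m + n then cmod (arc_transform (parcs G) \<sigma> N\<^sub>1 m n) else 0) +
        (if N\<^sub>1 dvd m + n then cmod (arc_transform (parcs H) \<tau> N\<^sub>2 m n) else 0))"
    using arc_transform_cartesian_product[OF G H \<sigma>(1) \<tau>(1)] pos assms(3,4)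
    by (intro sum_mono) (auto intro: norm_triangle_ineq)
  also have "\<dots> = real N\<^sub>2 * ?A + real N\<^sub>1 * ?B"
    using sum_arc_transform_restrict[of N\<^sub>1 N\<^sub>2 "parcs G" \<sigma>]
      sum_arc_transform_restrict[of N\<^sub>2 N\<^sub>1 "parcs H" \<tau>] cop pos
    by (simp add: sum.distrib coprime_commute mult.commute[of N\<^sub>2 N\<^sub>1])
  finally have l1: "(\<Sum>m<?N. \<Sum>n<?N. cmod (arc_transform (parcs ?P) ?\<rho> ?N m n)) \<le>
      real N\<^sub>2 * ?A + real N\<^sub>1 * ?B" .
  \<comment> \<open>Summing the constant 1 over the arcs counts them: each arc of one factor occurs
    once per vertex of the other.\<close>
  have cardP: "card (parcs ?P) = 2 * (N\<^sub>2 * s\<^sub>G + N\<^sub>1 * s\<^sub>H)"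
    using sum_parcs_cartesian_product[OF G H, of "\<lambda>_ _. 1::nat"] assms
    by (simp add: card_parcs_eq[OF G] card_parcs_eq[OF H] algebra_simps)
  \<comment> \<open>The \<open>sqrt 2\<close> stems from the two arcs per edge and cancels in the
    final quotient. Positive edge counts allow the denominator to be cleared.\<close>
  have A: "?A = sqrt 2 * (sqrt (real s\<^sub>G) * edge_complexity G)"
    using fourier_ratio_adjacency[OF G \<sigma>(1)] \<sigma>(2) assms pos
    by (simp add: card_parcs_eq[OF G] real_sqrt_mult)
  have B: "?B = sqrt 2 * (sqrt (real s\<^sub>H) * edge_complexity H)"
    using fourier_ratio_adjacency[OF H \<tau>(1)] \<tau>(2) assms pos
    by (simp add: card_parcs_eq[OF H] real_sqrt_mult)
  have "edge_complexity ?P \<le> fourier_ratio (adjacency_matrix ?P ?\<rho>)"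
    using P \<rho> by (rule edge_complexity_le)
  also have "\<dots> = (\<Sum>m<?N. \<Sum>n<?N. cmod (arc_transform (parcs ?P) ?\<rho> ?N m n))
      / sqrt (real (card (parcs ?P)))"
    using fourier_ratio_adjacency[OF P \<rho>] pos assms(3,4)
    by (simp add: graph_order_cartesian_product)
  also have "\<dots> \<le> (real N\<^sub>2 * ?A + real N\<^sub>1 * ?B) / sqrt (real (card (parcs ?P)))"
    by (intro divide_right_mono l1) simp
  also have "\<dots> = (sqrt 2 * (real N\<^sub>2 * sqrt (real s\<^sub>G) * edge_complexity G +
        real N\<^sub>1 * sqrt (real s\<^sub>H) * edge_complexity H))
      / (sqrt 2 * sqrt (real N\<^sub>2 * real s\<^sub>G + real N\<^sub>1 * real s\<^sub>H))"
    unfolding A B cardP by (simp add: algebra_simps flip: real_sqrt_mult)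
  also have "\<dots> = (real N\<^sub>2 * sqrt (real s\<^sub>G) * edge_complexity G +
        real N\<^sub>1 * sqrt (real s\<^sub>H) * edge_complexity H)
      / sqrt (real N\<^sub>2 * real s\<^sub>G + real N\<^sub>1 * real s\<^sub>H)"
    by simp
  finally show ?thesis .
qed

end
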